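(* Let $\mathbb{V}$ be a finite dimensional vector space of dimension $n\ge 3$ over the field of $2$ elements, with basis $\{b_1,\dots,b_n\}$, and let $G(\mathbb{V})$ be its non-zero component graph. Let $u,v\in T_{i'}$ for some $i'$ with $2\le i'\le n-1$ be such that $S_u\cap S_v\neq\emptyset$. If $r=i'-|S_u\cap S_v|$, then, for $1\le i\le n-1$, $$|fix(u,v)\cap T_i|=\binom{n}{i}-\sum_{\substack{0\le j\le r\\ 0\le k\le n-2r\\ i=2j+k}}\binom{r}{j}^2\binom{n-2r}{k}-\binom{n-2r}{i},$$ where $j,k$ are two numbers such that $i=2j+k$.
   Context: The non-zero component graph $G(\mathbb{V})$ (with respect to the basis $\{b_1,\dots,b_n\}$) has as vertices the non-zero vectors of $\mathbb{V}$; two distinct vertices are adjacent iff some $b_l$ has non-zero coefficient in both of their expansions in the basis. The skeleton $S_u$ of a vertex $u$ is the set of basis vectors having non-zero coefficient in the expansion of $u$. $T_i=\{v\in V(G(\mathbb{V})): |S_v|=i\}$ for $1\le i\le n$. For a graph $G$, $\Gamma(G)$ is its automorphism group, $\Gamma_x(G)$ is the stabilizer of the vertex $x$, $\mathcal{O}(u)$ is the orbit of $u$ under $\Gamma(G)$, and $\mathcal{O}_x(u)=\{g(u): g\in\Gamma_x(G)\}$. $S(G)=\{v\in V(G): |\mathcal{O}(v)|\ge 2\}$. For $(u,v)\in S(G)\times S(G)$, the fixing neighborhood is $fix(u,v)=\{x\in S(G): \mathcal{O}_x(u)\ne\mathcal{O}_x(v)\}$ (with $fix(u,v)=\emptyset$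 for distinct $u,v$ with $\mathcal{O}(u)\neq\mathcal{O}(v)$). Here $fix(u,v)$ is taken in $G=G(\mathbb{V})$. Binomial coefficients $\binom{a}{b}$ with $0\le a<b$ are $0$.
   Formalization: The sum is taken over 1 ≤ j ≤ r instead of 0 ≤ j ≤ r: as printed, the j = 0 term equals the separate term C(n−2r, i), which is thus subtracted twice, and the formula fails (n=3, S_u={b1,b2}, S_v={b2,b3}, i=1: it gives 1, the true value is 2). *)

theory Defs
  imports Complex_Main "HOL-Combinatorics.Permutations"
begin

section \<open>Fixing neighborhoods in finite graphs\<close>

record 'a graph =
  verts :: "'a set"
  adj :: "'a \<Rightarrow> 'a \<Rightarrow> bool"

text \<open>Automorphisms are normalised to be the identity outside the vertex set, so that they
  are permutations of that set in the sense of \<^const>\<open>permutes\<close>.\<close>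

definition automorphisms :: "'a graph \<Rightarrow> ('a \<Rightarrow> 'a) set" where
  "automorphisms G =
     {g. g permutes verts G \<and> (\<forall>x\<in>verts G. \<forall>y\<in>verts G. adj G (g x) (g y) \<longleftrightarrow> adj G x y)}"

definition stabilizer :: "'a graph \<Rightarrow> 'a \<Rightarrow> ('a \<Rightarrow> 'a) set" where
  "stabilizer G x = {g \<in> automorphisms G. g x = x}"

definition orbit :: "'a graph \<Rightarrow> 'a \<Rightarrow> 'a set" where
  "orbit G u = {g u | g. g \<in> automorphisms G}"

definition stab_orbit :: "'a graph \<Rightarrow> 'a \<Rightarrow> 'a \<Rightarrow> 'a set" where
  "stab_orbit G x u = {g u | g. g \<in> stabilizer G x}"

text \<open>Meant for graphs with finite orbits: \<^const>\<open>card\<close> is 0 on an infinite orbit.\<close>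

definition moved_verts :: "'a graph \<Rightarrow> 'a set" where
  "moved_verts G = {v \<in> verts G. 2 \<le> card (orbit G v)}"

definition fixing_nbhd :: "'a graph \<Rightarrow> 'a \<Rightarrow> 'a \<Rightarrow> 'a set" where
  "fixing_nbhd G u v =
     (if u \<noteq> v \<and> orbit G u \<noteq> orbit G v then {}
      else {x \<in> moved_verts G. stab_orbit G x u \<noteq> stab_orbit G x v})"

section \<open>The non-zero component graph of a vector space with a basis\<close>

definition skeleton ::
  "('k::field \<Rightarrow> 'v::ab_group_add \<Rightarrow> 'v) \<Rightarrow> 'v set \<Rightarrow> 'v \<Rightarrow> 'v set" where
  "skeleton scale B u = {b \<in> B. module.representation scale B u b \<noteq> 0}"

definition nonzero_component_graph ::
  "('k::field \<Rightarrow> 'v::ab_group_add \<Rightarrow> 'v) \<Rightarrow> 'v set \<Rightarrow> 'v graph" where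
  "nonzero_component_graph scale B =
     \<lparr> verts = {u. u \<noteq> 0},
       adj = (\<lambda>u v. u \<noteq> v \<and>
         (\<exists>b\<in>B. module.representation scale B u b \<noteq> 0 \<and>
                module.representation scale B v b \<noteq> 0)) \<rparr>"

definition skeleton_class ::
  "('k::field \<Rightarrow> 'v::ab_group_add \<Rightarrow> 'v) \<Rightarrow> 'v set \<Rightarrow> nat \<Rightarrow> 'v set" where
  "skeleton_class scale B i =
     {v \<in> verts (nonzero_component_graph scale B). card (skeleton scale B v) = i}"

end

(* Over the field of two elements a vector is determined by its skeleton, so the graph is the
   intersection graph of the non-empty subsets of B.  An automorphism preserves the number of
   common non-neighbours of two vertices, hence the sizes of unions and intersections of their
   skeletons, while every permutation of B induces an automorphism.  Therefore x fails to
   separate u and v exactly when its skeleton meets those of u and v in equally many points,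
   i.e. meets the two differences (of size r each) in the same number j of points and the other
   n - 2r basis vectors in k points. *)

theory Submission
  imports Defs
begin

section \<open>Automorphism groups and their orbits\<close>

lemma automorphisms_comp:
  "\<lbrakk>g \<in> automorphisms G; h \<in> automorphisms G\<rbrakk> \<Longrightarrow> g \<circ> h \<in> automorphisms G"
  by (auto simp: automorphisms_def permutes_compose permutes_in_image)

lemma automorphisms_inv:
  assumes "g \<in> automorphisms G"
  shows "inv g \<in> automorphisms G"
proof -
  have g: "g permutes verts G"
    using assms by (simp add: automorphisms_def)
  have "adj G (inv g x) (inv g y) \<longleftrightarrow> adj G x y" if "x \<in> verts G" "y \<in> verts G" for x y
  proof -
    have "inv g x \<in> verts G" "inv g y \<in> verts G"
      using that permutes_in_image[OF permutes_inv[OF g]] by auto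
    then have "adj G (g (inv g x)) (g (inv g y)) \<longleftrightarrow> adj G (inv g x) (inv g y)"
      using assms by (simp add: automorphisms_def)
    then show ?thesis by (simp add: permutes_inverses[OF g])
  qed
  then show ?thesis
    using permutes_inv[OF g] by (simp add: automorphisms_def)
qed

lemma id_in_automorphisms: "id \<in> automorphisms G"
  by (simp add: automorphisms_def permutes_id)

lemma orbit_automorphism:
  assumes "g \<in> automorphisms G"
  shows "orbit G (g u) = orbit G u"
proof
  show "orbit G (g u) \<subseteq> orbit G u"
  proof
    fix w assume "w \<in> orbit G (g u)"
    then obtain h where h: "h \<in> automorphisms G" "w = (h \<circ> g) u"
      by (auto simp: orbit_def)
    then show "w \<in> orbit G u"
      using automorphisms_comp[OF h(1) assms] unfolding orbit_def by blast
  qed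
  show "orbit G u \<subseteq> orbit G (g u)"
  proof
    fix w assume "w \<in> orbit G u"
    then obtain h where h: "h \<in> automorphisms G" "w = h u"
      by (auto simp: orbit_def)
    have "w = (h \<circ> inv g) (g u)"
      using assms h by (auto simp: automorphisms_def permutes_inverses)
    then show "w \<in> orbit G (g u)"
      using automorphisms_comp[OF h(1) automorphisms_inv[OF assms]] unfolding orbit_def by blast
  qed
qed

lemma stab_orbit_stabilizer:
  assumes "g \<in> stabilizer G x"
  shows "stab_orbit G x (g u) = stab_orbit G x u"
proof
  have g: "g \<in> automorphisms G" "g x = x" "g permutes verts G"
    using assms by (auto simp: stabilizer_def automorphisms_def)
  show "stab_orbit G x (g u) \<subseteq> stab_orbit G x u"
  proof
    fix w assume "w \<in> stab_orbit G x (g u)"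
    then obtain h where h: "h \<in> stabilizer G x" "w = (h \<circ> g) u"
      by (auto simp: stab_orbit_def)
    have "h \<circ> g \<in> stabilizer G x"
      using h(1) g automorphisms_comp by (auto simp: stabilizer_def)
    then show "w \<in> stab_orbit G x u"
      unfolding h(2) stab_orbit_def by blast
  qed
  show "stab_orbit G x u \<subseteq> stab_orbit G x (g u)"
  proof
    fix w assume "w \<in> stab_orbit G x u"
    then obtain h where h: "h \<in> stabilizer G x" "w = h u"
      by (auto simp: stab_orbit_def)
    have "inv g x = x"
      using g(2) permutes_inverses(2)[OF g(3), of x] by simp
    then have "h \<circ> inv g \<in> stabilizer G x"
      using h(1) g(1) by (auto simp: stabilizer_def intro: automorphisms_comp automorphisms_inv)
    moreover have "w = (h \<circ> inv g) (g u)"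
      using h(2) by (simp add: permutes_inverses(2)[OF g(3)])
    ultimately show "w \<in> stab_orbit G x (g u)"
      unfolding stab_orbit_def by blast
  qed
qed

section \<open>Permutations and counting for subsets of a finite set\<close>

text \<open>Colour each point of \<open>B\<close> by its membership in \<open>X\<close> and in
  \<open>U\<close>, and again by its membership in \<open>X\<close> and in \<open>V\<close>. The
  cardinality hypotheses make corresponding colour classes equally large, so some permutation
  carries the first colouring to the second; its first coordinate gives invariance of
  \<open>X\<close>, its second sends \<open>U\<close> to \<open>V\<close>.\<close>

lemma permutation_between_subsets:
  assumes "finite B" "X \<subseteq> B" "U \<subseteq> B" "V \<subseteq> B"
    and "card U = card V" "card (X \<inter> U) = card (X \<inter> V)"
  obtains p where "p permutes B" "p ` X = X" "p ` U = V"
proof -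
  define c where "c = (\<lambda>W b. (b \<in> X, b \<in> W))"
  have fin: "finite X" "finite U" "finite V"
    using assms(1-4) by (auto intro: finite_subset)
  \<comment> \<open>The class sizes are written through \<open>card W\<close> and
    \<open>card (X \<inter> W)\<close> only, the two quantities on which \<open>U\<close> and
    \<open>V\<close> agree.\<close>
  have count: "count (image_mset (c W) (mset_set B)) (s, t) =
      (if s then if t then card (X \<inter> W) else card X - card (X \<inter> W)
       else if t then card W - card (X \<inter> W) else card B - (card X + card W - card (X \<inter> W)))"
    if W: "W \<subseteq> B" for W s t
  proof -
    have fW: "finite W" using W assms(1) finite_subset by blast
    have "count (image_mset (c W) (mset_set B)) (s, t) = card {b \<in> B. (s, t) = c W b}"
      using assms(1) by (simp add: count_image_mset')
    also have "{b \<in> B. (s, t) = c W b} =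
        (if s then if t then X \<inter> W else X - X \<inter> W
         else if t then W - X \<inter> W else B - (X \<union> W))"
      using W assms(2) by (auto simp: c_def)
    also have "card \<dots> = (if s then if t then card (X \<inter> W) else card X - card (X \<inter> W)
       else if t then card W - card (X \<inter> W) else card B - card (X \<union> W))"
      using W assms(2) fin fW by (simp add: card_Diff_subset)
    also have "card (X \<union> W) = card X + card W - card (X \<inter> W)"
      using card_Un_Int[OF fin(1) fW] by simp
    finally show ?thesis .
  qed
  have "image_mset (c U) (mset_set B) = image_mset (c V) (mset_set B)"
  proof (rule multiset_eqI)
    fix st :: "bool \<times> bool"
    obtain s t where st: "st = (s, t)" by fastforce
    show "count (image_mset (c U) (mset_set B)) st = count (image_mset (c V) (mset_set B)) st"
      unfolding st count[OF assms(3)] count[OF assms(4)] assms(5,6) ..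
  qed
  then obtain p where p: "p permutes B" "\<forall>b\<in>B. c U b = c V (p b)"
    using image_mset_eq_implies_permutes[OF assms(1)] by blast
  have onto: "\<exists>a\<in>B. b = p a" if "b \<in> B" for b
    using that permutes_image[OF p(1)] by blast
  have "p ` X = X"
    using p(2) assms(2) onto by (fastforce simp: c_def)
  moreover have "p ` U = V"
    using p(2) assms(3,4) onto by (fastforce simp: c_def)
  ultimately show thesis using p(1) that by blast
qed

text \<open>A subset of a disjoint union amounts to the triple of its traces on the three pieces,
  and these can be chosen independently.\<close>

lemma card_subsets_prescribed_Int:
  assumes "finite D" "finite E" "finite F" "D \<inter> E = {}" "D \<inter> F = {}" "E \<inter> F = {}"
  shows "card {X. X \<subseteq> D \<union> E \<union> F \<and> card (X \<inter> D) = a \<and> card (X \<inter> E) = b \<and> card (X \<inter> F) = c}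
       = (card D choose a) * (card E choose b) * (card F choose c)"
proof -
  let ?S = "\<lambda>A k. {X. X \<subseteq> A \<and> card X = k}"
  let ?L = "{X. X \<subseteq> D \<union> E \<union> F \<and> card (X \<inter> D) = a \<and> card (X \<inter> E) = b \<and> card (X \<inter> F) = c}"
  have parts: "(X \<union> Y \<union> Z) \<inter> D = X" "(X \<union> Y \<union> Z) \<inter> E = Y" "(X \<union> Y \<union> Z) \<inter> F = Z"
    if "X \<subseteq> D" "Y \<subseteq> E" "Z \<subseteq> F" for X Y Z
    using that assms(4-6) by blast+
  have "bij_betw (\<lambda>X. (X \<inter> D, X \<inter> E, X \<inter> F)) ?L (?S D a \<times> ?S E b \<times> ?S F c)"
  proof (rule bij_betw_byWitness[where f' = "\<lambda>(X, Y, Z). X \<union> Y \<union> Z"])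
    show "\<forall>X\<in>?L. (\<lambda>(X, Y, Z). X \<union> Y \<union> Z) (X \<inter> D, X \<inter> E, X \<inter> F) = X"
      by auto
    show "\<forall>t\<in>?S D a \<times> ?S E b \<times> ?S F c. (\<lambda>X. (X \<inter> D, X \<inter> E, X \<inter> F)) ((\<lambda>(X, Y, Z). X \<union> Y \<union> Z) t) = t"
      using parts by (simp add: split_paired_all)
    show "(\<lambda>X. (X \<inter> D, X \<inter> E, X \<inter> F)) ` ?L \<subseteq> ?S D a \<times> ?S E b \<times> ?S F c"
      by auto
    show "(\<lambda>(X, Y, Z). X \<union> Y \<union> Z) ` (?S D a \<times> ?S E b \<times> ?S F c) \<subseteq> ?L"
      using parts by auto
  qed
  then have "card ?L = card (?S D a \<times> ?S E b \<times> ?S F c)"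
    by (rule bij_betw_same_card)
  then show ?thesis
    using assms(1-3) by (simp add: card_cartesian_product n_subsets)
qed

text \<open>Sort the subsets by their common trace size j on \<open>D\<close> and \<open>E\<close>
  and their trace size k on the rest of \<open>B\<close>. The traces on \<open>D\<close> and on
  \<open>E\<close> are chosen independently, each in \<open>r choose j\<close> ways, whence the
  square.\<close>

lemma card_balanced_subsets:
  assumes B: "finite B" and DE: "D \<subseteq> B" "E \<subseteq> B" "D \<inter> E = {}"
    and r: "card D = r" "card E = r"
  shows "card {X. X \<subseteq> B \<and> card X = i \<and> card (X \<inter> D) = card (X \<inter> E)} =
    (\<Sum>(j, k) \<in> {(j, k). j \<le> r \<and> k \<le> card B - 2 * r \<and> i = 2 * j + k}.
       (r choose j)\<^sup>2 * ((card B - 2 * r) choose k))"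
proof -
  define F where "F = B - (D \<union> E)"
  let ?I = "{(j, k). j \<le> r \<and> k \<le> card B - 2 * r \<and> i = 2 * j + k}"
  let ?P = "\<lambda>j k. {X. X \<subseteq> D \<union> E \<union> F \<and> card (X \<inter> D) = j \<and> card (X \<inter> E) = j \<and> card (X \<inter> F) = k}"
  have fin: "finite D" "finite E" "finite F"
    using finite_subset[OF DE(1) B] finite_subset[OF DE(2) B] B by (simp_all add: F_def)
  have B_eq: "B = D \<union> E \<union> F"
    using DE by (auto simp: F_def)
  have disj: "D \<inter> F = {}" "E \<inter> F = {}"
    by (auto simp: F_def)
  \<comment> \<open>Since \<open>D\<close> and \<open>E\<close> are disjoint subsets of
    \<open>B\<close>, 2r is at most \<open>card B\<close> and the truncated subtraction is
    exact.\<close>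
  have cF: "card F = card B - 2 * r"
    using fin DE r card_Un_disjoint[OF fin(1,2) DE(3)]
    by (simp add: F_def card_Diff_subset)
  have card_split: "card X = card (X \<inter> D) + card (X \<inter> E) + card (X \<inter> F)" if "X \<subseteq> B" for X
  proof -
    have "X = (X \<inter> D) \<union> (X \<inter> E) \<union> (X \<inter> F)"
      using that B_eq by blast
    then have "card X = card ((X \<inter> D) \<union> (X \<inter> E) \<union> (X \<inter> F))" by simp
    also have "\<dots> = card ((X \<inter> D) \<union> (X \<inter> E)) + card (X \<inter> F)"
      using fin disj by (intro card_Un_disjoint) auto
    also have "card ((X \<inter> D) \<union> (X \<inter> E)) = card (X \<inter> D) + card (X \<inter> E)"
      using fin DE by (intro card_Un_disjoint) auto
    finally show ?thesis .
  qed
  have fibres: "{X. X \<subseteq> B \<and> card X = i \<and> card (X \<inter> D) = card (X \<inter> E)} = (\<Union>(j, k)\<in>?I. ?P j k)"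
  proof (intro equalityI subsetI)
    fix X assume X: "X \<in> {X. X \<subseteq> B \<and> card X = i \<and> card (X \<inter> D) = card (X \<inter> E)}"
    \<comment> \<open>The bounds on j and k in the index set exclude no subset, as a trace is no
      larger than the piece it lies in.\<close>
    have "card (X \<inter> D) \<le> r" "card (X \<inter> F) \<le> card B - 2 * r"
      using card_mono[OF fin(1), of "X \<inter> D"] card_mono[OF fin(3), of "X \<inter> F"] r cF by auto
    then have "(card (X \<inter> D), card (X \<inter> F)) \<in> ?I"
      using X card_split[of X] by auto
    then show "X \<in> (\<Union>(j, k)\<in>?I. ?P j k)"
      using X B_eq by force
  next
    fix X assume "X \<in> (\<Union>(j, k)\<in>?I. ?P j k)"
    then show "X \<in> {X. X \<subseteq> B \<and> card X = i \<and> card (X \<inter> D) = card (X \<inter> E)}"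
      using card_split[of X] B_eq by auto
  qed
  have card_UN: "card (\<Union>(j, k)\<in>?I. ?P j k) = (\<Sum>(j, k)\<in>?I. card (?P j k))"
  proof -
    have "finite ?I"
      by (rule finite_subset[of _ "{..r} \<times> {..card B - 2 * r}"]) auto
    moreover have "\<forall>jk\<in>?I. finite (case jk of (j, k) \<Rightarrow> ?P j k)"
      using fin by auto
    moreover have "\<forall>x\<in>?I. \<forall>y\<in>?I. x \<noteq> y \<longrightarrow>
        (case x of (j, k) \<Rightarrow> ?P j k) \<inter> (case y of (j, k) \<Rightarrow> ?P j k) = {}"
      by auto
    ultimately have "card (\<Union>jk\<in>?I. case jk of (j, k) \<Rightarrow> ?P j k)
        = (\<Sum>jk\<in>?I. card (case jk of (j, k) \<Rightarrow> ?P j k))"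
      by (rule card_UN_disjoint)
    then show ?thesis by (simp only: case_prod_unfold)
  qed
  have card_P: "card (?P j k) = (r choose j)\<^sup>2 * ((card B - 2 * r) choose k)" for j k
    using card_subsets_prescribed_Int[OF fin DE(3) disj, of j j k] r cF
    by (simp add: power2_eq_square)
  show ?thesis
    unfolding fibres card_UN card_P by (rule refl)
qed

text \<open>The points of \<open>X\<close> in \<open>U \<inter> V\<close> contribute equally to both
  sides and cancel. This replaces \<open>U\<close> and \<open>V\<close> by disjoint sets, as the
  count of balanced subsets requires.\<close>

lemma card_Int_eq_iff_card_Int_Diff_eq:
  assumes "finite U" "finite V"
  shows "card (X \<inter> U) = card (X \<inter> V) \<longleftrightarrow> card (X \<inter> (U - V)) = card (X \<inter> (V - U))"
proof -
  have split: "card (X \<inter> U) = card (X \<inter> (U - V)) + card (X \<inter> (U \<inter> V))" if "finite U" for U V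
    using that by (subst card_Un_disjoint[symmetric]) (auto intro!: arg_cong[where f = card])
  show ?thesis
    using split[OF assms(1), of V] split[OF assms(2), of U] by (simp add: Int_commute)
qed

section \<open>Automorphisms of the intersection graph of the non-empty subsets of a finite
  set\<close>

text \<open>The linear algebra is set aside here: \<open>f\<close> will be the skeleton map, and
  only its bijectivity onto the non-empty subsets and its description of adjacency enter the
  arguments.\<close>

locale intersection_graph =
  fixes G :: "'a graph" and f :: "'a \<Rightarrow> 'b set" and B :: "'b set"
  assumes finite_B: "finite B"
    and bij_f: "bij_betw f (verts G) (Pow B - {{}})"
    and adj_iff: "\<lbrakk>x \<in> verts G; y \<in> verts G\<rbrakk> \<Longrightarrow> adj G x y \<longleftrightarrow> x \<noteq> y \<and> f x \<inter> f y \<noteq> {}"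
begin

lemma finite_verts: "finite (verts G)"
  using bij_betw_finite[OF bij_f] finite_B by simp

lemma f_subset: "x \<in> verts G \<Longrightarrow> f x \<subseteq> B" and f_nonempty: "x \<in> verts G \<Longrightarrow> f x \<noteq> {}"
  using bij_betwE[OF bij_f] by auto

lemma finite_f: "x \<in> verts G \<Longrightarrow> finite (f x)"
  using f_subset finite_B finite_subset by blast

lemma f_eq_iff: "\<lbrakk>x \<in> verts G; y \<in> verts G\<rbrakk> \<Longrightarrow> f x = f y \<longleftrightarrow> x = y"
  using bij_betw_imp_inj_on[OF bij_f] by (auto dest: inj_onD)

lemma automorphism_in_verts: "\<lbrakk>g \<in> automorphisms G; x \<in> verts G\<rbrakk> \<Longrightarrow> g x \<in> verts G"
  by (auto simp: automorphisms_def permutes_in_image)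

text \<open>For distinct vertices disjointness is non-adjacency. Adjacency says nothing about a
  vertex and itself, but there both sides fail because the sets are non-empty.\<close>

lemma automorphism_disjoint_iff:
  assumes "g \<in> automorphisms G" "x \<in> verts G" "y \<in> verts G"
  shows "f (g x) \<inter> f (g y) = {} \<longleftrightarrow> f x \<inter> f y = {}"
proof (cases "x = y")
  case True
  then show ?thesis using assms automorphism_in_verts f_nonempty by simp
next
  case False
  then have "g x \<noteq> g y"
    using assms(1) permutes_inj[of g "verts G"] by (auto simp: automorphisms_def dest: injD)
  moreover have "adj G (g x) (g y) \<longleftrightarrow> adj G x y"
    using assms by (auto simp: automorphisms_def)
  ultimately show ?thesis using assms False adj_iff automorphism_in_verts by simp
qed

text \<open>These vertices correspond to the subsets of \<open>B - A\<close>; the 1 subtracted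
  accounts for the empty set, which belongs to no vertex.\<close>

lemma card_disjoint_verts:
  assumes "A \<subseteq> B"
  shows "card {z \<in> verts G. f z \<inter> A = {}} = 2 ^ (card B - card A) - 1"
proof -
  have "f ` {z \<in> verts G. f z \<inter> A = {}} = {X \<in> f ` verts G. X \<inter> A = {}}"
    by blast
  also have "\<dots> = Pow (B - A) - {{}}"
    unfolding bij_betw_imp_surj_on[OF bij_f] by blast
  finally have "f ` {z \<in> verts G. f z \<inter> A = {}} = Pow (B - A) - {{}}" .
  moreover have "card (f ` {z \<in> verts G. f z \<inter> A = {}}) = card {z \<in> verts G. f z \<inter> A = {}}"
    by (rule card_image) (rule inj_on_subset[OF bij_betw_imp_inj_on[OF bij_f]], blast)
  ultimately show ?thesis
    using assms finite_B by (simp add: card_Pow card_Diff_subset finite_subset)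
qed

text \<open>The number of vertices disjoint from both \<open>x\<close> and \<open>y\<close> is an invariant that determines
  the size of the union of their sets.\<close>

lemma automorphism_card_Un:
  assumes "g \<in> automorphisms G" "x \<in> verts G" "y \<in> verts G"
  shows "card (f (g x) \<union> f (g y)) = card (f x \<union> f y)"
proof -
  let ?N = "\<lambda>x y. {z \<in> verts G. f z \<inter> (f x \<union> f y) = {}}"
  have g: "g permutes verts G"
    using assms(1) by (simp add: automorphisms_def)
  have disj: "f (g z) \<inter> (f (g x) \<union> f (g y)) = {} \<longleftrightarrow> f z \<inter> (f x \<union> f y) = {}"
    if "z \<in> verts G" for z
    using automorphism_disjoint_iff[OF assms(1) that assms(2)]
      automorphism_disjoint_iff[OF assms(1) that assms(3)]
    by (simp add: Int_Un_distrib)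
  have "g ` ?N x y = ?N (g x) (g y)"
  proof (intro equalityI subsetI)
    fix z assume "z \<in> g ` ?N x y"
    then show "z \<in> ?N (g x) (g y)"
      using disj automorphism_in_verts[OF assms(1)] by blast
  next
    fix z assume z: "z \<in> ?N (g x) (g y)"
    then obtain w where "w \<in> verts G" "z = g w"
      using permutes_image[OF g] by blast
    then show "z \<in> g ` ?N x y"
      using disj z by blast
  qed
  then have "card (?N (g x) (g y)) = card (?N x y)"
    using card_image[OF permutes_inj_on[OF g], of "?N x y"] by simp
  moreover have sub: "f x \<union> f y \<subseteq> B" "f (g x) \<union> f (g y) \<subseteq> B"
    using assms f_subset automorphism_in_verts by auto
  ultimately have "(2::nat) ^ (card B - card (f (g x) \<union> f (g y))) - 1
                 = 2 ^ (card B - card (f x \<union> f y)) - 1"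
    by (simp add: card_disjoint_verts)
  \<comment> \<open>Powers of 2 are positive, so subtracting 1 loses nothing and the exponents
    agree. As both unions lie in \<open>B\<close>, the truncated differences then determine their
    sizes.\<close>
  then have "card B - card (f (g x) \<union> f (g y)) = card B - card (f x \<union> f y)"
    by (metis One_nat_def Suc_pred zero_less_power pos2 power_inject_exp one_less_numeral_iff semiring_norm(76))
  then show ?thesis
    using sub card_mono[OF finite_B] by (metis diff_diff_cancel)
qed

lemma automorphism_card:
  "\<lbrakk>g \<in> automorphisms G; x \<in> verts G\<rbrakk> \<Longrightarrow> card (f (g x)) = card (f x)"
  using automorphism_card_Un[of g x x] by simp

text \<open>Inclusion-exclusion turns the invariance of union sizes into that of intersection sizes,
  the invariant that will tell stabilizer orbits apart.\<close>

lemma automorphism_card_Int: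
  assumes "g \<in> automorphisms G" "x \<in> verts G" "y \<in> verts G"
  shows "card (f (g x) \<inter> f (g y)) = card (f x \<inter> f y)"
proof -
  have "card (f (g x)) + card (f (g y)) = card (f (g x) \<union> f (g y)) + card (f (g x) \<inter> f (g y))"
    "card (f x) + card (f y) = card (f x \<union> f y) + card (f x \<inter> f y)"
    using assms automorphism_in_verts by (auto intro!: card_Un_Int finite_f)
  then show ?thesis
    using assms by (simp add: automorphism_card automorphism_card_Un)
qed

text \<open>A permutation of \<open>B\<close> maps non-empty subsets to non-empty subsets and
  respects disjointness, so transporting its action through \<open>f\<close> gives an
  automorphism.\<close>

lemma automorphism_of_permutation:
  assumes p: "p permutes B"
  obtains g where "g \<in> automorphisms G" "\<And>x. x \<in> verts G \<Longrightarrow> f (g x) = p ` f x"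
proof -
  \<comment> \<open>The identity outside \<open>verts G\<close> matches the normalisation built into
    \<open>automorphisms\<close>.\<close>
  define g where "g = (\<lambda>x. if x \<in> verts G then the_inv_into (verts G) f (p ` f x) else x)"
  have inj_p: "inj p" using p by (rule permutes_inj)
  have img: "p ` f x \<in> f ` verts G" if "x \<in> verts G" for x
    using f_subset[OF that] f_nonempty[OF that] permutes_image[OF p]
    unfolding bij_betw_imp_surj_on[OF bij_f] by blast
  have g_in: "g x \<in> verts G" and f_g: "f (g x) = p ` f x" if "x \<in> verts G" for x
    using that img[OF that] bij_betw_imp_inj_on[OF bij_f]
    by (auto simp: g_def intro!: the_inv_into_into f_the_inv_into_f)
  have inj_g: "inj_on g (verts G)"
  proof (rule inj_onI)
    fix x y assume "x \<in> verts G" "y \<in> verts G" "g x = g y"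
    then have "p ` f x = p ` f y" using f_g by metis
    then show "x = y"
      using \<open>x \<in> verts G\<close> \<open>y \<in> verts G\<close> inj_p by (simp add: inj_image_eq_iff f_eq_iff)
  qed
  \<comment> \<open>An injective self-map of a finite set is onto.\<close>
  moreover have "g ` verts G = verts G"
    using g_in by (intro endo_inj_surj[OF finite_verts _ inj_g]) auto
  ultimately have "g permutes verts G"
    by (intro bij_imp_permutes) (auto simp: bij_betw_def g_def)
  moreover have "adj G (g x) (g y) \<longleftrightarrow> adj G x y" if "x \<in> verts G" "y \<in> verts G" for x y
  proof -
    have "f (g x) \<inter> f (g y) = p ` (f x \<inter> f y)"
      using that f_g by (simp add: image_Int[OF inj_p])
    then show ?thesis
      using that g_in inj_g by (auto simp: adj_iff inj_on_eq_iff)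
  qed
  ultimately have "g \<in> automorphisms G"
    by (simp add: automorphisms_def)
  then show thesis using f_g that by blast
qed

text \<open>This keeps \<open>fixing_nbhd\<close> out of its default empty branch for skeletons of
  equal size. No vertex has to be fixed, so the invariant set of the permutation lemma is taken
  empty.\<close>

lemma orbit_eq:
  assumes "u \<in> verts G" "v \<in> verts G" "card (f u) = card (f v)"
  shows "orbit G u = orbit G v"
proof -
  obtain p where p: "p permutes B" "p ` f u = f v"
    using permutation_between_subsets[OF finite_B empty_subsetI f_subset f_subset, of u v] assms
    by auto
  obtain g where "g \<in> automorphisms G" "f (g u) = f v"
    using automorphism_of_permutation[OF p(1)] p(2) assms(1) by metis
  then show ?thesis
    using assms orbit_automorphism automorphism_in_verts f_eq_iff by metis
qed

text \<open>If the orbits agree, an automorphism fixing \<open>x\<close> takes \<open>v\<close> to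
  \<open>u\<close>, and it preserves intersection sizes. Conversely, equal intersection sizes
  provide a permutation of \<open>B\<close> that preserves \<open>f x\<close> and sends
  \<open>f u\<close> to \<open>f v\<close>; the automorphism it induces fixes \<open>x\<close> and
  takes \<open>u\<close> to \<open>v\<close>.\<close>

lemma stab_orbit_eq_iff:
  assumes "x \<in> verts G" "u \<in> verts G" "v \<in> verts G" "card (f u) = card (f v)"
  shows "stab_orbit G x u = stab_orbit G x v \<longleftrightarrow> card (f x \<inter> f u) = card (f x \<inter> f v)"
proof
  assume "stab_orbit G x u = stab_orbit G x v"
  moreover have "u \<in> stab_orbit G x u"
    using id_in_automorphisms[of G] by (auto simp: stab_orbit_def stabilizer_def intro!: exI[of _ id])
  ultimately obtain g where "g \<in> automorphisms G" "g x = x" "u = g v"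
    by (auto simp: stab_orbit_def stabilizer_def)
  then show "card (f x \<inter> f u) = card (f x \<inter> f v)"
    using automorphism_card_Int[of g x v] assms by simp
next
  assume "card (f x \<inter> f u) = card (f x \<inter> f v)"
  then obtain p where p: "p permutes B" "p ` f x = f x" "p ` f u = f v"
    using permutation_between_subsets[OF finite_B f_subset f_subset f_subset, of x u v] assms
    by auto
  then obtain g where g: "g \<in> automorphisms G" "f (g x) = f x" "f (g u) = f v"
    using automorphism_of_permutation[OF p(1)] assms by metis
  then have "g x = x" "g u = v"
    using assms automorphism_in_verts f_eq_iff by metis+
  then show "stab_orbit G x u = stab_orbit G x v"
    using g stab_orbit_stabilizer[of g G x u] by (simp add: stabilizer_def)
qed

text \<open>Swapping a point of \<open>f x\<close> with a point of \<open>B\<close> outside it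
  induces an automorphism that moves \<open>x\<close>.\<close>

lemma in_moved_verts:
  assumes "x \<in> verts G" "f x \<noteq> B"
  shows "x \<in> moved_verts G"
proof -
  obtain a b where ab: "a \<in> f x" "b \<in> B - f x"
    using assms f_subset f_nonempty by blast
  then have "transpose a b permutes B"
    using f_subset assms by (intro permutes_swap_id) auto
  then obtain g where g: "g \<in> automorphisms G" "f (g x) = transpose a b ` f x"
    using automorphism_of_permutation assms(1) by metis
  have "b \<in> f (g x)"
    using ab(1) g(2) by (metis image_eqI transpose_apply_first)
  then have "g x \<noteq> x" using ab by auto
  moreover have "g x \<in> orbit G x"
    using g(1) by (auto simp: orbit_def)
  moreover have "x \<in> orbit G x"
    using id_in_automorphisms[of G] by (auto simp: orbit_def intro!: exI[of _ id])
  \<comment> \<open>An infinite orbit would have \<open>card\<close> 0, so two distinct elements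
    alone do not suffice.\<close>
  moreover have "finite (orbit G x)"
    using assms automorphism_in_verts
    by (intro finite_subset[OF _ finite_verts]) (auto simp: orbit_def)
  ultimately have "card {g x, x} \<le> card (orbit G x)"
    by (intro card_mono) auto
  then show ?thesis
    using \<open>g x \<noteq> x\<close> assms by (simp add: moved_verts_def)
qed

text \<open>The vertices of size i split into those that separate \<open>u\<close> from
  \<open>v\<close> and those that meet both sets equally. The additive form avoids truncated
  subtraction on \<open>nat\<close>.\<close>

lemma card_fixing_nbhd:
  assumes u: "u \<in> verts G" and v: "v \<in> verts G" and uv: "card (f u) = card (f v)"
    and i: "0 < i" "i < card B"
  defines "r \<equiv> card (f u) - card (f u \<inter> f v)"
  shows "card {x \<in> fixing_nbhd G u v. card (f x) = i} +
    (\<Sum>(j, k) \<in> {(j, k). j \<le> r \<and> k \<le> card B - 2 * r \<and> i = 2 * j + k}.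
       (r choose j)\<^sup>2 * ((card B - 2 * r) choose k)) = card B choose i"
proof -
  let ?eq = "\<lambda>X. card (X \<inter> f u) = card (X \<inter> f v)"
  let ?S = "{X. X \<subseteq> B \<and> card X = i}"
  \<comment> \<open>As \<open>i < card B\<close>, no vertex of size i has the whole of
    \<open>B\<close> as its set, so all of them are moved vertices.\<close>
  have "{x \<in> fixing_nbhd G u v. card (f x) = i} = {x \<in> verts G. card (f x) = i \<and> \<not> ?eq (f x)}"
    using orbit_eq[OF u v uv] stab_orbit_eq_iff[OF _ u v uv] in_moved_verts i
    by (auto simp: fixing_nbhd_def) (auto simp: moved_verts_def)
  moreover have "f ` {x \<in> verts G. card (f x) = i \<and> \<not> ?eq (f x)} = {X \<in> ?S. \<not> ?eq X}"
  proof -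
    have "f ` {x \<in> verts G. card (f x) = i \<and> \<not> ?eq (f x)}
        = {X \<in> f ` verts G. card X = i \<and> \<not> ?eq X}"
      by blast
    \<comment> \<open>The empty set, the one subset of \<open>B\<close> outside the image of
      \<open>f\<close>, is ruled out by \<open>0 < i\<close>.\<close>
    then show ?thesis
      unfolding bij_betw_imp_surj_on[OF bij_f] using i by auto
  qed
  moreover have "inj_on f {x \<in> verts G. card (f x) = i \<and> \<not> ?eq (f x)}"
    by (rule inj_on_subset[OF bij_betw_imp_inj_on[OF bij_f]]) blast
  ultimately have nbhd: "card {x \<in> fixing_nbhd G u v. card (f x) = i} = card {X \<in> ?S. \<not> ?eq X}"
    using card_image[of f "{x \<in> verts G. card (f x) = i \<and> \<not> ?eq (f x)}"] by simp
  have "card (f u - f v) = r" "card (f v - f u) = r"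
    using uv finite_f[OF u] finite_f[OF v]
    by (auto simp: r_def card_Diff_subset_Int Int_commute)
  then have "card {X. X \<subseteq> B \<and> card X = i \<and> card (X \<inter> (f u - f v)) = card (X \<inter> (f v - f u))} =
      (\<Sum>(j, k) \<in> {(j, k). j \<le> r \<and> k \<le> card B - 2 * r \<and> i = 2 * j + k}.
         (r choose j)\<^sup>2 * ((card B - 2 * r) choose k))"
    using f_subset[OF u] f_subset[OF v] by (intro card_balanced_subsets finite_B) auto
  moreover have "{X. X \<subseteq> B \<and> card X = i \<and> card (X \<inter> (f u - f v)) = card (X \<inter> (f v - f u))}
      = {X \<in> ?S. ?eq X}"
    using card_Int_eq_iff_card_Int_Diff_eq[OF finite_f[OF u] finite_f[OF v]] by blast
  moreover have "card {X \<in> ?S. \<not> ?eq X} + card {X \<in> ?S. ?eq X} = card ?S"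
  proof -
    have "card ({X \<in> ?S. \<not> ?eq X} \<union> {X \<in> ?S. ?eq X}) = card {X \<in> ?S. \<not> ?eq X} + card {X \<in> ?S. ?eq X}"
      using finite_B by (intro card_Un_disjoint) (auto intro: finite_subset[of _ "Pow B"])
    moreover have "{X \<in> ?S. \<not> ?eq X} \<union> {X \<in> ?S. ?eq X} = ?S" by blast
    ultimately show ?thesis by simp
  qed
  ultimately show ?thesis
    using nbhd n_subsets[OF finite_B] by simp
qed

end

section \<open>Skeletons over the field of two elements\<close>

lemma two_element_field_cases:
  assumes "card (UNIV :: 'k::field set) = 2"
  shows "(c :: 'k) = 0 \<or> c = 1"
proof -
  have "finite (UNIV :: 'k set)"
    using assms card.infinite by fastforce
  then have "{0, 1} = (UNIV :: 'k set)"
    using assms by (intro card_subset_eq) auto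
  then show ?thesis by blast
qed

text \<open>Every non-zero coefficient is 1, so a vector is the sum of its skeleton; hence summing a
  subset of the basis inverts \<open>skeleton scale B\<close>.\<close>

lemma bij_betw_skeleton:
  fixes scale :: "'k::field \<Rightarrow> 'v::ab_group_add \<Rightarrow> 'v"
  assumes k: "card (UNIV :: 'k set) = 2"
    and "finite_dimensional_vector_space scale B"
  shows "bij_betw (skeleton scale B) UNIV (Pow B)"
proof -
  interpret finite_dimensional_vector_space scale B by fact
  have coeff: "representation B u b = (if b \<in> skeleton scale B u then 1 else 0)" if "b \<in> B" for u b
    using that two_element_field_cases[OF k] by (auto simp: skeleton_def)
  have "skeleton scale B (\<Sum>X) = X" if "X \<subseteq> B" for X
  proof -
    have "representation B (\<Sum>X) b = (if b \<in> X then 1 else 0)" for b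
    proof -
      have "representation B (\<Sum>X) b = (\<Sum>a\<in>X. representation B a b)"
        using representation_sum[OF independent_Basis, of X "\<lambda>x. x"] by (simp add: span_Basis)
      also have "\<dots> = (\<Sum>a\<in>X. if b = a then 1 else 0)"
        using that representation_basis[OF independent_Basis] by (intro sum.cong) auto
      also have "\<dots> = (if b \<in> X then 1 else 0)"
        using that finite_Basis finite_subset by (subst sum.delta') auto
      finally show ?thesis .
    qed
    then show ?thesis using that by (auto simp: skeleton_def)
  qed
  moreover have "\<Sum>(skeleton scale B u) = u" for u
  proof -
    have "u = (\<Sum>b\<in>B. scale (representation B u b) b)"
      by (simp add: sum_representation_eq independent_Basis span_Basis finite_Basis)
    also have "\<dots> = (\<Sum>b\<in>B. if b \<in> skeleton scale B u then b else 0)"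
      using coeff by (intro sum.cong) auto
    also have "\<dots> = (\<Sum>b\<in>B \<inter> skeleton scale B u. b)"
      using finite_Basis by (simp add: sum.inter_restrict)
    also have "B \<inter> skeleton scale B u = skeleton scale B u"
      by (auto simp: skeleton_def)
    finally show ?thesis by simp
  qed
  ultimately show ?thesis
    by (intro bij_betw_byWitness[where f' = "\<lambda>X. \<Sum>X"]) (auto simp: skeleton_def)
qed

lemma intersection_graph_nonzero_component_graph:
  fixes scale :: "'k::field \<Rightarrow> 'v::ab_group_add \<Rightarrow> 'v"
  assumes "card (UNIV :: 'k set) = 2"
    and fd: "finite_dimensional_vector_space scale B"
  shows "intersection_graph (nonzero_component_graph scale B) (skeleton scale B) B"
proof
  interpret finite_dimensional_vector_space scale B by fact
  show "finite B" by (rule finite_Basis)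
  \<comment> \<open>The zero vector is the one paired with the empty set; deleting both leaves the
    vertices and the non-empty subsets.\<close>
  have "skeleton scale B 0 = {}"
    by (simp add: skeleton_def representation_zero)
  then have "bij_betw (skeleton scale B) (UNIV - {0}) (Pow B - {{}})"
    using bij_betw_DiffI[OF bij_betw_skeleton[OF assms], of "{0}" "{{}}"] by (simp add: bij_betw_def)
  then show "bij_betw (skeleton scale B) (verts (nonzero_component_graph scale B)) (Pow B - {{}})"
    by (simp add: nonzero_component_graph_def Compl_eq_Diff_UNIV[symmetric] Compl_eq)
qed (auto simp: nonzero_component_graph_def skeleton_def)

theorem corollary3p6:
  fixes scale :: "'k::field \<Rightarrow> 'v::ab_group_add \<Rightarrow> 'v"
    and B :: "'v set"
    and n i' i r :: nat
    and u v :: 'v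
  assumes "card (UNIV :: 'k set) = 2"
    and "finite_dimensional_vector_space scale B"
    and "card B = n"
    and "n \<ge> 3"
    and "2 \<le> i'" and "i' \<le> n - 1"
    and "u \<in> skeleton_class scale B i'"
    and "v \<in> skeleton_class scale B i'"
    and "skeleton scale B u \<inter> skeleton scale B v \<noteq> {}"
    and "r = i' - card (skeleton scale B u \<inter> skeleton scale B v)"
    and "1 \<le> i" and "i \<le> n - 1"
  shows "int (card (fixing_nbhd (nonzero_component_graph scale B) u v \<inter> skeleton_class scale B i)) =
           int (n choose i)
           - (\<Sum>(j, k) \<in> {(j, k). 1 \<le> j \<and> j \<le> r \<and> k \<le> n - 2 * r \<and> i = 2 * j + k}.
                int ((r choose j)\<^sup>2 * ((n - 2 * r) choose k)))
           - int ((n - 2 * r) choose i)"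
proof -
  let ?G = "nonzero_component_graph scale B"
  let ?t = "\<lambda>j k. int ((r choose j)\<^sup>2 * ((n - 2 * r) choose k))"
  let ?I = "{(j, k). j \<le> r \<and> k \<le> n - 2 * r \<and> i = 2 * j + k}"
  let ?J = "{(j, k). 1 \<le> j \<and> j \<le> r \<and> k \<le> n - 2 * r \<and> i = 2 * j + k}"
  interpret intersection_graph ?G "skeleton scale B" B
    using assms(1,2) by (rule intersection_graph_nonzero_component_graph)
  have "fixing_nbhd ?G u v \<inter> skeleton_class scale B i
      = {x \<in> fixing_nbhd ?G u v. card (skeleton scale B x) = i}"
    by (auto simp: skeleton_class_def fixing_nbhd_def moved_verts_def split: if_splits)
  moreover have "card {x \<in> fixing_nbhd ?G u v. card (skeleton scale B x) = i} +
      (\<Sum>(j, k)\<in>?I. (r choose j)\<^sup>2 * ((n - 2 * r) choose k)) = n choose i"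
    using card_fixing_nbhd[of u v i] assms by (auto simp: skeleton_class_def)
  moreover have "int (\<Sum>(j, k)\<in>?I. (r choose j)\<^sup>2 * ((n - 2 * r) choose k)) = (\<Sum>(j, k)\<in>?I. ?t j k)"
    by (simp add: case_prod_unfold)
  ultimately have "int (card (fixing_nbhd ?G u v \<inter> skeleton_class scale B i))
      + (\<Sum>(j, k)\<in>?I. ?t j k) = int (n choose i)"
    by (simp only: flip: of_nat_add)
  \<comment> \<open>The term with j = 0 forces k = i and equals \<open>(n - 2 * r) choose i\<close>.
    The conclusion subtracts it separately, so its sum starts at j = 1 and this term is not counted
    twice.\<close>
  moreover have "(\<Sum>(j, k)\<in>?I. ?t j k) = (\<Sum>(j, k)\<in>?J. ?t j k) + int ((n - 2 * r) choose i)"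
  proof -
    have fin: "finite ?J"
      by (rule finite_subset[of _ "{..r} \<times> {..n - 2 * r}"]) auto
    show ?thesis
    proof (cases "i \<le> n - 2 * r")
      case True
      then have "?I = insert (0, i) ?J"
        by (auto simp: Suc_le_eq)
      then show ?thesis
        using fin by simp
    next
      case False
      \<comment> \<open>Now k = i is out of range, so no pair has j = 0, and the separate binomial
        coefficient vanishes.\<close>
      then have "?I = ?J"
        by (auto simp: Suc_le_eq intro: gr0I)
      then show ?thesis
        using False by (simp add: binomial_eq_0)
    qed
  qed
  ultimately show ?thesis by simp
qed

end
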